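(* Let $(X,\kappa)$ be a digital image with the approximate fixed point property (AFPP). Let $n \ge 0$ and $v \ge 1$ be integers and let $Y = [0,n]_{\mathbb{Z}}^v$. Then the digital image $(X \times Y,\, NP(\kappa,c_v))$ has the AFPP.
   Context: A digital image $(X,\kappa)$ is a set $X$ (of lattice points in some $\mathbb{Z}^m$) together with an adjacency relation $\kappa$ on $X$, i.e., a symmetric irreflexive relation. Write $x \leftrightarrow_\kappa y$ if $x,y$ are $\kappa$-adjacent. A subset $A\subset X$ is $\kappa$-connected if for all $a,b \in A$ there is a sequence $a=x_0,\dots,x_k=b$ in $A$ with $x_i \leftrightarrow_\kappa x_{i+1}$ or $x_i = x_{i+1}$ for $0\le i<k$. A function $f: X \to X$ is $\kappa$-continuous if it maps $\kappa$-connected subsets to $\kappa$-connected subsets (equivalently, $x \leftrightarrow_\kappa x'$ implies that $f(x) \leftrightarrow_\kappa f(x')$ or $f(x) = f(x')$). $(X,\kappa)$ has the AFPP if for every $\kappa$-continuous $f: X \to X$ there is a point $x\in X$ with $f(x) \leftrightarrow_\kappa x$ or $f(x) = x$. For integers $a \le b$, $[a,b]_{\mathbb{Z}} = \{t \in \mathbb{Z} : a \le t \le b\}$. For $1 \le u \le m$, distinct points $x,y\in\mathbb{Z}^m$ are $c_u$-adjacent if there are at most $u$ indices $i$ with $|x_i-y_i|=1$, and $x_j=y_j$ for all indices $j$ with $|x_j-y_j|\ne 1$. For digital images $(X,\kappa)$ and $(Y,\lambda)$, the normal product adjacency $NP(\kappa,\lambda)$ on $X\times Y$ is: $(x,y)$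 and $(x',y')$ are adjacent iff ($x \leftrightarrow_\kappa x'$ and $y=y'$), or ($x=x'$ and $y \leftrightarrow_\lambda y'$), or ($x \leftrightarrow_\kappa x'$ and $y \leftrightarrow_\lambda y'$). *)

theory Defs
  imports "HOL-Analysis.Finite_Cartesian_Product"
begin

text \<open>
  A digital image is a carrier \<open>X\<close> with an adjacency \<open>\<kappa>\<close>, given as a relation on the whole ambient
  type of which only the restriction to \<open>X\<close> matters; likewise a map \<open>X \<rightarrow> Y\<close> is a total function
  whose values outside \<open>X\<close> are irrelevant.  The notions are polymorphic in the type of points, so
  that they apply both to sets of lattice points, i.e. subsets of \<^typ>\<open>int ^ 'm\<close>, and to products
  of such sets, whose points are pairs.
\<close>

definition digital_image :: "'a set \<Rightarrow> ('a \<Rightarrow> 'a \<Rightarrow> bool) \<Rightarrow> bool" where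
  "digital_image X \<kappa> \<longleftrightarrow> symp_on X \<kappa> \<and> irreflp_on X \<kappa>"

definition digitally_connected :: "('a \<Rightarrow> 'a \<Rightarrow> bool) \<Rightarrow> 'a set \<Rightarrow> bool" where
  "digitally_connected \<kappa> A \<longleftrightarrow>
     (\<forall>a\<in>A. \<forall>b\<in>A. \<exists>(k::nat) x. x 0 = a \<and> x k = b \<and> (\<forall>i\<le>k. x i \<in> A) \<and>
        (\<forall>i<k. \<kappa> (x i) (x (Suc i)) \<or> x i = x (Suc i)))"

definition digitally_continuous ::
    "'a set \<Rightarrow> ('a \<Rightarrow> 'a \<Rightarrow> bool) \<Rightarrow> 'b set \<Rightarrow> ('b \<Rightarrow> 'b \<Rightarrow> bool) \<Rightarrow> ('a \<Rightarrow> 'b) \<Rightarrow> bool" where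
  "digitally_continuous X \<kappa> Y \<mu> f \<longleftrightarrow>
     f ` X \<subseteq> Y \<and> (\<forall>A\<subseteq>X. digitally_connected \<kappa> A \<longrightarrow> digitally_connected \<mu> (f ` A))"

definition AFPP :: "'a set \<Rightarrow> ('a \<Rightarrow> 'a \<Rightarrow> bool) \<Rightarrow> bool" where
  "AFPP X \<kappa> \<longleftrightarrow>
     (\<forall>f. digitally_continuous X \<kappa> X \<kappa> f \<longrightarrow> (\<exists>x\<in>X. \<kappa> (f x) x \<or> f x = x))"

definition c_adj :: "nat \<Rightarrow> int ^ 'm \<Rightarrow> int ^ 'm \<Rightarrow> bool" where
  "c_adj u x y \<longleftrightarrow>
     x \<noteq> y \<and> card {i. \<bar>x $ i - y $ i\<bar> = 1} \<le> u \<and>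
     (\<forall>j. \<bar>x $ j - y $ j\<bar> \<noteq> 1 \<longrightarrow> x $ j = y $ j)"

definition normal_product ::
    "('a \<Rightarrow> 'a \<Rightarrow> bool) \<Rightarrow> ('b \<Rightarrow> 'b \<Rightarrow> bool) \<Rightarrow> 'a \<times> 'b \<Rightarrow> 'a \<times> 'b \<Rightarrow> bool" where
  "normal_product \<kappa> \<mu> p q \<longleftrightarrow>
     \<kappa> (fst p) (fst q) \<and> snd p = snd q \<or>
     fst p = fst q \<and> \<mu> (snd p) (snd q) \<or>
     \<kappa> (fst p) (fst q) \<and> \<mu> (snd p) (snd q)"

definition digital_cube :: "int \<Rightarrow> (int ^ 'v) set" where
  "digital_cube n = {y. \<forall>i. y $ i \<in> {0..n}}"

lemma digital_image_c_adj: "digital_image X (c_adj u)"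
  unfolding digital_image_def c_adj_def symp_on_def irreflp_on_def
  by (auto simp: abs_minus_commute)

lemma digital_image_normal_product:
  assumes "digital_image X \<kappa>" and "digital_image Y \<mu>"
  shows "digital_image (X \<times> Y) (normal_product \<kappa> \<mu>)"
  using assms unfolding digital_image_def normal_product_def symp_on_def irreflp_on_def
  by auto

lemma digitally_continuous_iff:
  assumes X: "digital_image X \<kappa>" and Y: "digital_image Y \<mu>"
  shows "digitally_continuous X \<kappa> Y \<mu> f \<longleftrightarrow>
    f ` X \<subseteq> Y \<and> (\<forall>x\<in>X. \<forall>x'\<in>X. \<kappa> x x' \<longrightarrow> \<mu> (f x) (f x') \<or> f x = f x')"
proof (intro iffI conjI ballI impI)
  assume f: "digitally_continuous X \<kappa> Y \<mu> f"
  then show sub: "f ` X \<subseteq> Y" by (simp add: digitally_continuous_def)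
  fix x x' assume x: "x \<in> X" "x' \<in> X" "\<kappa> x x'"
  then have x': "\<kappa> x' x" using X by (auto simp: digital_image_def symp_on_def)
  have "digitally_connected \<kappa> {x, x'}"
    unfolding digitally_connected_def
  proof (intro ballI)
    fix a b assume "a \<in> {x, x'}" "b \<in> {x, x'}"
    then show "\<exists>(k::nat) z. z 0 = a \<and> z k = b \<and> (\<forall>i\<le>k. z i \<in> {x, x'}) \<and>
        (\<forall>i<k. \<kappa> (z i) (z (Suc i)) \<or> z i = z (Suc i))"
      using x x' by (intro exI[of _ 1] exI[of _ "\<lambda>i. if i = 0 then a else b"]) auto
  qed
  then have "digitally_connected \<mu> (f ` {x, x'})"
    using f x(1,2) unfolding digitally_continuous_def by (metis empty_subsetI insert_subset)
  then have "\<exists>(k::nat) z. z 0 = f x \<and> z k = f x' \<and> (\<forall>i\<le>k. z i \<in> {f x, f x'}) \<and>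
      (\<forall>i<k. \<mu> (z i) (z (Suc i)) \<or> z i = z (Suc i))"
    unfolding digitally_connected_def by simp
  then obtain k :: nat and z where z: "z 0 = f x" "z k = f x'" "\<forall>i\<le>k. z i \<in> {f x, f x'}"
      "\<forall>i<k. \<mu> (z i) (z (Suc i)) \<or> z i = z (Suc i)"
    by (elim exE conjE) (rule that)
  show "\<mu> (f x) (f x') \<or> f x = f x'"
  proof (rule ccontr)
    assume neg: "\<not> ?thesis"
    have "i \<le> k \<longrightarrow> z i = f x" for i
    proof (induction i)
      case (Suc i)
      show ?case
      proof
        assume i: "Suc i \<le> k"
        then have "z i = f x" "z (Suc i) \<in> {f x, f x'}" "\<mu> (z i) (z (Suc i)) \<or> z i = z (Suc i)"
          using Suc z(3) spec[OF z(4), of i] by auto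
        with neg show "z (Suc i) = f x" by auto
      qed
    qed (simp add: z(1))
    then have "f x' = f x" using z(2) by auto
    with neg show False by simp
  qed
next
  assume f: "f ` X \<subseteq> Y \<and> (\<forall>x\<in>X. \<forall>x'\<in>X. \<kappa> x x' \<longrightarrow> \<mu> (f x) (f x') \<or> f x = f x')"
  show "digitally_continuous X \<kappa> Y \<mu> f"
    unfolding digitally_continuous_def
  proof (intro conjI allI impI)
    fix A assume A: "A \<subseteq> X" "digitally_connected \<kappa> A"
    show "digitally_connected \<mu> (f ` A)"
      unfolding digitally_connected_def
    proof (intro ballI)
      fix a' b' assume "a' \<in> f ` A" "b' \<in> f ` A"
      then obtain a b where ab: "a \<in> A" "b \<in> A" "a' = f a" "b' = f b" by auto
      then obtain k :: nat and z where z: "z 0 = a" "z k = b" "\<forall>i\<le>k. z i \<in> A"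
          "\<forall>i<k. \<kappa> (z i) (z (Suc i)) \<or> z i = z (Suc i)"
        using A(2)[unfolded digitally_connected_def, rule_format, OF ab(1,2)]
        by (elim exE conjE) (rule that)
      have "\<mu> (f (z i)) (f (z (Suc i))) \<or> f (z i) = f (z (Suc i))" if "i < k" for i
      proof -
        have "z i \<in> X" "z (Suc i) \<in> X" using z(3) A(1) that by auto
        then show ?thesis using f spec[OF z(4), of i] that by auto
      qed
      then show "\<exists>(k::nat) y. y 0 = a' \<and> y k = b' \<and> (\<forall>i\<le>k. y i \<in> f ` A) \<and>
          (\<forall>i<k. \<mu> (y i) (y (Suc i)) \<or> y i = y (Suc i))"
        using z(1-3) ab(3,4) by (intro exI[of _ k] exI[of _ "\<lambda>i. f (z i)"]) simp
    qed
  qed (use f in auto)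
qed

end

theory Submission
  imports Defs
begin

text \<open>
  By induction on the number of coordinates it suffices to multiply \<open>X\<close> by one interval
  \<open>{0..n}\<close>, that is, to find an approximate fixed point of a continuous self-map \<open>f\<close> of
  \<open>X \<times> {0..n}\<close>.  Write \<open>x \<simeq> y\<close> for "adjacent or equal" and \<open>f (x, t) = (g\<^sub>t x, h\<^sub>t x)\<close>.
  The AFPP of \<open>X\<close> gives every slice map \<open>g\<^sub>t\<close> an approximate fixed point, but a choice made
  separately for each \<open>t\<close> need not be coherent.  What makes the theorem true is that
  approximate fixed points can be carried from one slice to the next: if \<open>g\<^sub>t x \<simeq> x\<close>, put
  \<open>x' = g\<^sub>t x\<close>.  Then \<open>(x', t + 1)\<close> and \<open>(x, t)\<close> are adjacent in the normal product, so their
  images are adjacent or equal; the first coordinate of this says \<open>g\<^sub>t\<^sub>+\<^sub>1 x' \<simeq> g\<^sub>t x = x'\<close>,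
  so that \<open>x'\<close> is an approximate fixed point of \<open>g\<^sub>t\<^sub>+\<^sub>1\<close>.  Starting from an approximate fixed
  point of \<open>g\<^sub>0\<close> one obtains a path \<open>(x\<^sub>t, t)\<close> from the bottom to the top of \<open>X \<times> {0..n}\<close>,
  along which \<open>h\<^sub>t x\<^sub>t - t\<close> starts nonnegative, ends nonpositive, and decreases by at most 2 in
  each step.  Such a sequence meets \<open>{-1, 0, 1}\<close>, and there \<open>(x\<^sub>t, t)\<close> is an approximate fixed
  point of \<open>f\<close>.
  This is lemma \<open>reflexive_AFPP_times_interval\<close>.

  The argument sees adjacency only through the relation \<open>\<simeq>\<close>, for which the normal product
  becomes the componentwise relation, and \<open>c\<^sub>v\<close> on \<open>\<int>\<^sup>v\<close> becomes distance at most 1 in the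
  maximum norm.
\<close>

definition adj_or_eq :: "('a \<Rightarrow> 'a \<Rightarrow> bool) \<Rightarrow> 'a \<Rightarrow> 'a \<Rightarrow> bool" where
  "adj_or_eq \<kappa> x y \<longleftrightarrow> \<kappa> x y \<or> x = y"

definition reflexive_AFPP :: "('a \<Rightarrow> 'a \<Rightarrow> bool) \<Rightarrow> 'a set \<Rightarrow> bool" where
  "reflexive_AFPP R X \<longleftrightarrow>
     (\<forall>f. f ` X \<subseteq> X \<longrightarrow> (\<forall>x\<in>X. \<forall>x'\<in>X. R x x' \<longrightarrow> R (f x) (f x')) \<longrightarrow> (\<exists>x\<in>X. R (f x) x))"

lemma reflexive_AFPPD:
  assumes "reflexive_AFPP R X"
    and "\<And>x. x \<in> X \<Longrightarrow> f x \<in> X"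
    and "\<And>x x'. x \<in> X \<Longrightarrow> x' \<in> X \<Longrightarrow> R x x' \<Longrightarrow> R (f x) (f x')"
  obtains x where "x \<in> X" "R (f x) x"
proof -
  have "f ` X \<subseteq> X" using assms(2) by auto
  with assms(1,3) show ?thesis
    using that unfolding reflexive_AFPP_def by blast
qed

lemma AFPP_iff_reflexive_AFPP:
  assumes "digital_image X \<kappa>"
  shows "AFPP X \<kappa> \<longleftrightarrow> reflexive_AFPP (adj_or_eq \<kappa>) X"
proof -
  have "(\<forall>x\<in>X. \<forall>x'\<in>X. adj_or_eq \<kappa> x x' \<longrightarrow> adj_or_eq \<kappa> (f x) (f x')) \<longleftrightarrow>
      (\<forall>x\<in>X. \<forall>x'\<in>X. \<kappa> x x' \<longrightarrow> \<kappa> (f x) (f x') \<or> f x = f x')" for f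
    unfolding adj_or_eq_def by blast
  then show ?thesis
    unfolding AFPP_def reflexive_AFPP_def digitally_continuous_iff[OF assms assms]
    by (simp add: adj_or_eq_def imp_conjL)
qed

lemma adj_or_eq_normal_product:
  "adj_or_eq (normal_product \<kappa> \<mu>) p q \<longleftrightarrow>
     adj_or_eq \<kappa> (fst p) (fst q) \<and> adj_or_eq \<mu> (snd p) (snd q)"
  unfolding adj_or_eq_def normal_product_def prod_eq_iff by blast

text \<open>
  When \<open>u\<close> is the full dimension, the bound on the number of changing coordinates always
  holds; and an integer of absolute value at most 1 is 0 or has absolute value exactly 1.
\<close>

lemma adj_or_eq_c_adj_dimension:
  fixes x y :: "int ^ 'v"
  shows "adj_or_eq (c_adj CARD('v)) x y \<longleftrightarrow> (\<forall>i. \<bar>x $ i - y $ i\<bar> \<le> 1)"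
proof -
  have "card {i. \<bar>x $ i - y $ i\<bar> = 1} \<le> CARD('v)"
    by (rule card_mono) auto
  moreover have "\<bar>x $ i - y $ i\<bar> \<le> 1 \<longleftrightarrow> \<bar>x $ i - y $ i\<bar> = 1 \<or> x $ i = y $ i" for i
    by linarith
  ultimately show ?thesis
    unfolding adj_or_eq_def c_adj_def vec_eq_iff by auto
qed

text \<open>
  The property passes to retracts: a self-map \<open>f\<close> of the retract \<open>B\<close> induces the self-map
  \<open>s \<circ> f \<circ> r\<close> of \<open>A\<close>, and \<open>r\<close> sends an approximate fixed point of the latter to one of \<open>f\<close>.
  The retractions needed here are isomorphisms that rearrange the coordinates of a product.
\<close>

lemma reflexive_AFPP_retract:
  assumes A: "reflexive_AFPP R A"
    and r: "\<And>a. a \<in> A \<Longrightarrow> r a \<in> B"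
      "\<And>a a'. a \<in> A \<Longrightarrow> a' \<in> A \<Longrightarrow> R a a' \<Longrightarrow> S (r a) (r a')"
    and s: "\<And>b. b \<in> B \<Longrightarrow> s b \<in> A"
      "\<And>b b'. b \<in> B \<Longrightarrow> b' \<in> B \<Longrightarrow> S b b' \<Longrightarrow> R (s b) (s b')"
    and rs: "\<And>b. b \<in> B \<Longrightarrow> r (s b) = b"
  shows "reflexive_AFPP S B"
  unfolding reflexive_AFPP_def
proof (intro allI impI)
  fix f assume f: "f ` B \<subseteq> B" "\<forall>b\<in>B. \<forall>b'\<in>B. S b b' \<longrightarrow> S (f b) (f b')"
  have fB: "f b \<in> B" if "b \<in> B" for b using f(1) that by auto
  obtain a where a: "a \<in> A" "R (s (f (r a))) a"
    by (rule reflexive_AFPPD[OF A, of "\<lambda>a. s (f (r a))"]) (auto simp: r s fB f(2))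
  then have "S (r (s (f (r a)))) (r a)" by (intro r s fB)
  then show "\<exists>b\<in>B. S (f b) b" using a(1) by (auto simp: rs r fB)
qed

text \<open>
  The discrete intermediate value argument is run as an induction on \<open>t\<close> with the invariant
  that \<open>x\<close> is an approximate fixed point of the slice map at height \<open>t\<close> which \<open>f\<close> does not
  move downwards.  At height \<open>n\<close> there is no room to move upwards, which ends the induction.
\<close>

lemma reflexive_AFPP_times_interval:
  fixes n :: int
  assumes X: "reflexive_AFPP R X" and n: "0 \<le> n"
  shows "reflexive_AFPP (\<lambda>p q. R (fst p) (fst q) \<and> \<bar>snd p - snd q\<bar> \<le> 1) (X \<times> {0..n})"
    (is "reflexive_AFPP ?S ?Z")
  unfolding reflexive_AFPP_def
proof (intro allI impI)
  fix f assume "f ` ?Z \<subseteq> ?Z" and f: "\<forall>p\<in>?Z. \<forall>q\<in>?Z. ?S p q \<longrightarrow> ?S (f p) (f q)"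
  then have fZ: "f p \<in> ?Z" if "p \<in> ?Z" for p using that by blast
  show "\<exists>p\<in>?Z. ?S (f p) p"
  proof (rule ccontr)
    assume none: "\<not> ?thesis"
    have "t \<le> n \<longrightarrow> (\<exists>x\<in>X. R (fst (f (x, t))) x \<and> t \<le> snd (f (x, t)))" if "0 \<le> t" for t
      using that
    proof (induction t rule: int_ge_induct)
      case base
      have Z0: "(x, 0) \<in> ?Z" if "x \<in> X" for x using that n by simp
      obtain x where x: "x \<in> X" "R (fst (f (x, 0))) x"
      proof (rule reflexive_AFPPD[OF X, of "\<lambda>x. fst (f (x, 0))"])
        fix x assume "x \<in> X"
        then show "fst (f (x, 0)) \<in> X" using fZ[OF Z0] by (simp add: mem_Times_iff)
      next
        fix x x' assume "x \<in> X" "x' \<in> X" "R x x'"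
        then show "R (fst (f (x, 0))) (fst (f (x', 0)))"
          using f[rule_format, OF Z0 Z0] by simp
      qed
      moreover have "0 \<le> snd (f (x, 0))"
        using fZ[OF Z0[OF x(1)]] by (simp add: mem_Times_iff)
      ultimately show ?case by blast
    next
      case (step t)
      show ?case
      proof
        assume t: "t + 1 \<le> n"
        with step.IH obtain x where x: "x \<in> X" "R (fst (f (x, t))) x" "t \<le> snd (f (x, t))"
          by auto
        have Z: "(x, t) \<in> ?Z" using x(1) step.hyps t by simp
        have "\<not> ?S (f (x, t)) (x, t)" using none Z by blast
        with x(2,3) have up: "t + 2 \<le> snd (f (x, t))" by simp
        define x' where "x' = fst (f (x, t))"
        have x': "x' \<in> X" using fZ[OF Z] by (simp add: x'_def mem_Times_iff)
        have Z': "(x', t + 1) \<in> ?Z" using x' step.hyps t by simp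
        have "?S (x', t + 1) (x, t)" using x(2) by (simp add: x'_def)
        then have S: "?S (f (x', t + 1)) (f (x, t))" using f Z Z' by blast
        then have "R (fst (f (x', t + 1))) x'" by (simp add: x'_def)
        moreover have "t + 1 \<le> snd (f (x', t + 1))" using S up by linarith
        ultimately show "\<exists>x\<in>X. R (fst (f (x, t + 1))) x \<and> t + 1 \<le> snd (f (x, t + 1))"
          using x' by blast
      qed
    qed
    from this[of n] n obtain x where x: "x \<in> X" "R (fst (f (x, n))) x" "n \<le> snd (f (x, n))"
      by auto
    have Z: "(x, n) \<in> ?Z" using x(1) n by simp
    have "snd (f (x, n)) \<le> n" using fZ[OF Z] by (simp add: mem_Times_iff)
    with x(2,3) have "?S (f (x, n)) (x, n)" by simp
    with none Z show False by blast
  qed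
qed

text \<open>
  Since the dimension of \<^typ>\<open>int ^ 'v\<close> is a type, the induction on the dimension runs over the
  faces of the cube spanned by a set \<open>I\<close> of coordinates, all other coordinates being 0.
\<close>

definition cube_face :: "int \<Rightarrow> 'v set \<Rightarrow> (int ^ 'v) set" where
  "cube_face n I = {y. \<forall>j. y $ j \<in> (if j \<in> I then {0..n} else {0})}"

lemma reflexive_AFPP_times_cube_face:
  fixes I :: "'v::finite set"
  assumes X: "reflexive_AFPP R X" and n: "0 \<le> n"
  shows "reflexive_AFPP (\<lambda>p q. R (fst p) (fst q) \<and> (\<forall>i. \<bar>snd p $ i - snd q $ i\<bar> \<le> 1))
           (X \<times> cube_face n I)"
    (is "reflexive_AFPP ?S _")
  using finite[of I]
proof (induction I rule: finite_induct)
  case empty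
  have "y = 0" if "y \<in> cube_face n {}" for y :: "int ^ 'v"
    using that by (simp add: cube_face_def vec_eq_iff)
  then show ?case
    by (intro reflexive_AFPP_retract[OF X, where r = "\<lambda>x. (x, 0)" and s = fst])
      (auto simp: cube_face_def)
next
  case (insert i I)
  let ?set = "\<lambda>(y :: int ^ 'v) t. (\<chi> j. if j = i then t else y $ j) :: int ^ 'v"
  show ?case
  proof (rule reflexive_AFPP_retract[OF reflexive_AFPP_times_interval[OF insert.IH n],
        where r = "\<lambda>((x, y), t). (x, ?set y t)" and s = "\<lambda>(x, y). ((x, ?set y 0), y $ i)"])
    fix b assume "b \<in> X \<times> cube_face n (insert i I)"
    then show "(case b of (x, y) \<Rightarrow> ((x, ?set y 0), y $ i)) \<in> (X \<times> cube_face n I) \<times> {0..n}"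
      using insert.hyps(2) by (auto simp: cube_face_def split: if_splits)
  qed (auto simp: cube_face_def vec_eq_iff split: if_splits)
qed

theorem theorem4p7:
  fixes X :: "(int ^ 'm) set"
    and \<kappa> :: "int ^ 'm \<Rightarrow> int ^ 'm \<Rightarrow> bool"
    and n :: int
    and Y :: "(int ^ 'v) set"
  assumes "digital_image X \<kappa>"
    and "AFPP X \<kappa>"
    and "n \<ge> 0"
    and "Y = digital_cube n"
  shows "AFPP (X \<times> Y) (normal_product \<kappa> (c_adj CARD('v)))"
proof -
  have X: "reflexive_AFPP (adj_or_eq \<kappa>) X"
    using assms(1,2) AFPP_iff_reflexive_AFPP by blast
  have "Y = cube_face n UNIV"
    by (simp add: assms(4) digital_cube_def cube_face_def)
  moreover have "adj_or_eq (normal_product \<kappa> (c_adj CARD('v))) =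
      (\<lambda>p (q :: _ \<times> (int ^ 'v)). adj_or_eq \<kappa> (fst p) (fst q) \<and> (\<forall>i. \<bar>snd p $ i - snd q $ i\<bar> \<le> 1))"
    by (intro ext) (simp add: adj_or_eq_normal_product adj_or_eq_c_adj_dimension)
  ultimately have "reflexive_AFPP (adj_or_eq (normal_product \<kappa> (c_adj CARD('v)))) (X \<times> Y)"
    using reflexive_AFPP_times_cube_face[OF X assms(3), of UNIV] by simp
  moreover have "digital_image (X \<times> Y) (normal_product \<kappa> (c_adj CARD('v)))"
    by (rule digital_image_normal_product[OF assms(1) digital_image_c_adj])
  ultimately show ?thesis
    by (simp add: AFPP_iff_reflexive_AFPP)
qed

end
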